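(* Let $m,n\geq 1$ and let $c_1=(\sigma^{(m)},\dots,\sigma^{(1)})$ and $c_2=(\mu^{(m)},\dots,\mu^{(1)})$ be two metasylvester $m$-chains of size $n$. Then $c_1\leq c_2$ in the metasylvester lattice (i.e. $\psi(c_1)\leq\psi(c_2)$ for the corresponding metasylvester classes) if and only if $\sigma^{(i)}\leq\mu^{(i)}$ in the right weak order for all $1\leq i\leq m$.
   Context: For a permutation $\sigma\in\mathfrak{S}_n$, written as a word, $\mathrm{coinv}(\sigma)$ is the set of couples $(a,b)$ with $a<b$ such that $b$ appears before $a$ in $\sigma$. The right weak order on $\mathfrak{S}_n$ is: $\sigma\leq\mu$ iff $\mathrm{coinv}(\sigma)\subseteq\mathrm{coinv}(\mu)$. A metasylvester $m$-chain of size $n$ is a list $(\sigma^{(m)},\sigma^{(m-1)},\dots,\sigma^{(1)})$ of permutations in $\mathfrak{S}_n$ with $\sigma^{(m)}\leq\sigma^{(m-1)}\leq\dots\leq\sigma^{(1)}$ in the right weak order and such that for all $i<j$ the permutation $(\sigma^{(j)})^{-1}\sigma^{(i)}$ (composition $(fg)(k)=f(g(k))$) avoids the pattern $231$. An $m$-permutation of size $n$ is a rearrangement of the word $1^m2^m\cdots n^m$; their set is $\mathfrak{S}_n^{(m)}$. For a letter $b$, $b_i$ denotes the $i$-th occurrence of $b$ from the left. The order on $\mathfrak{S}_n^{(m)}$ (the $m$-permutations lattice) is inclusion of the sets of co-inversions $(a_i,b_j)$ ($a<b$ and $b_j$ appears before $a_i$). The metasylvester congruence $\equiv$ on $\mathfrak{S}_n^{(m)}$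 is the equivalence relation generated by $u\,ac\,v\,a\,w\equiv u\,ca\,v\,a\,w$ for letters $a<c$ and words $u,v,w$, and $u\,b\,v\,ac\,w\,b\,x\equiv u\,b\,v\,ca\,w\,b\,x$ for letters $a<b<c$ and words $u,v,w,x$. Each class contains a unique maximal element, the only one in the class containing no subword (not necessarily consecutive) $a\cdots b\cdots a$ with $a<b$. The metasylvester lattice is the set of metasylvester classes, ordered by comparing their maximal elements in the $m$-permutations lattice. For $1\leq a<b\leq n$ and $1\leq i\leq m$, the couple $(a,b_i)$ is a tree-inversion of a metasylvester class if, in the maximal element of the class, all letters $a$ are placed after the $i$-th occurrence of $b$. The map $\psi$ sends a metasylvester $m$-chain $c=(\sigma^{(m)},\dots,\sigma^{(1)})$ of size $n$ to the unique metasylvester class whose set of tree-inversions is $\{(a,b_i): 1\leq i\leq m,\ (a,b)\in\mathrm{coinv}(\sigma^{(i)})\}$; it is a bijection from metasylvester $m$-chains of size $n$ to metasylvester classes, and the metasylvester lattice is realized on chains by transporting the order through $\psi$. *)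

theory Defs
  imports Main "HOL-Library.Multiset" "HOL-Combinatorics.Permutations"
    "HOL-Combinatorics.Multiset_Permutations"
begin

text \<open>
  A permutation of size \<open>n\<close> is a function \<open>\<sigma>\<close> with \<open>\<sigma> permutes {1..n}\<close>; as a word it is
  \<open>\<sigma> 1, \<dots>, \<sigma> n\<close>, so letters are values and \<open>1..n\<close> are positions.
\<close>

definition coinv :: "nat \<Rightarrow> (nat \<Rightarrow> nat) \<Rightarrow> (nat \<times> nat) set" where
  "coinv n \<sigma> = {(a, b). a < b \<and> (\<exists>k l. 1 \<le> k \<and> k < l \<and> l \<le> n \<and> \<sigma> k = b \<and> \<sigma> l = a)}"

definition right_weak_le :: "nat \<Rightarrow> (nat \<Rightarrow> nat) \<Rightarrow> (nat \<Rightarrow> nat) \<Rightarrow> bool" where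
  "right_weak_le n \<sigma> \<mu> \<longleftrightarrow> coinv n \<sigma> \<subseteq> coinv n \<mu>"

definition avoids_231 :: "nat \<Rightarrow> (nat \<Rightarrow> nat) \<Rightarrow> bool" where
  "avoids_231 n \<sigma> \<longleftrightarrow>
     \<not> (\<exists>x y z. 1 \<le> x \<and> x < y \<and> y < z \<and> z \<le> n \<and> \<sigma> z < \<sigma> x \<and> \<sigma> x < \<sigma> y)"

text \<open>
  A chain \<open>(\<sigma>\<^sup>m, \<dots>, \<sigma>\<^sup>1)\<close> is a list in this (decreasing) order of the exponents, so the
  component with exponent \<open>i \<in> {1..m}\<close> is the \<open>i\<close>-th one from the right.
\<close>

definition component :: "(nat \<Rightarrow> nat) list \<Rightarrow> nat \<Rightarrow> nat \<Rightarrow> nat" where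
  "component c i = c ! (length c - i)"

definition metasylvester_chain :: "nat \<Rightarrow> nat \<Rightarrow> (nat \<Rightarrow> nat) list \<Rightarrow> bool" where
  "metasylvester_chain m n c \<longleftrightarrow>
     length c = m \<and>
     (\<forall>i\<in>{1..m}. component c i permutes {1..n}) \<and>
     (\<forall>i. 1 \<le> i \<and> i < m \<longrightarrow> right_weak_le n (component c (i + 1)) (component c i)) \<and>
     (\<forall>i j. 1 \<le> i \<and> i < j \<and> j \<le> m \<longrightarrow>
        avoids_231 n (inv (component c j) \<circ> component c i))"

definition m_permutations :: "nat \<Rightarrow> nat \<Rightarrow> nat list set" where
  "m_permutations m n =
     permutations_of_multiset (\<Sum>a\<in>{1..n}. replicate_mset m a)"

text \<open>Position \<open>k\<close> (counted from \<open>0\<close>) of the word \<open>w\<close> holds the \<open>i\<close>-th occurrence of \<open>b\<close>.\<close>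

definition occurs_at :: "nat list \<Rightarrow> nat \<Rightarrow> nat \<Rightarrow> nat \<Rightarrow> bool" where
  "occurs_at w b i k \<longleftrightarrow>
     k < length w \<and> w ! k = b \<and> count_list (take (Suc k) w) b = i"

definition m_coinv :: "nat list \<Rightarrow> ((nat \<times> nat) \<times> (nat \<times> nat)) set" where
  "m_coinv w = {((a, i), (b, j)). a < b \<and>
     (\<exists>k l. k < l \<and> occurs_at w b j k \<and> occurs_at w a i l)}"

definition m_perm_le :: "nat list \<Rightarrow> nat list \<Rightarrow> bool" where
  "m_perm_le u v \<longleftrightarrow> m_coinv u \<subseteq> m_coinv v"

inductive metasylvester_step :: "nat list \<Rightarrow> nat list \<Rightarrow> bool" where
  "a < c \<Longrightarrow>
     metasylvester_step (u @ [a, c] @ v @ [a] @ w) (u @ [c, a] @ v @ [a] @ w)"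
| "a < b \<Longrightarrow> b < c \<Longrightarrow>
     metasylvester_step (u @ [b] @ v @ [a, c] @ w @ [b] @ x) (u @ [b] @ v @ [c, a] @ w @ [b] @ x)"

text \<open>
  The steps preserve the multiset of letters, so the generated equivalence
  on all words restricts to the one generated on \<open>m\<close>-permutations.
\<close>

definition metasylvester_cong :: "nat \<Rightarrow> nat \<Rightarrow> (nat list \<times> nat list) set" where
  "metasylvester_cong m n = {(u, v).
     u \<in> m_permutations m n \<and> v \<in> m_permutations m n \<and> equivclp metasylvester_step u v}"

definition metasylvester_classes :: "nat \<Rightarrow> nat \<Rightarrow> nat list set set" where
  "metasylvester_classes m n = m_permutations m n // metasylvester_cong m n"

definition class_max :: "nat list set \<Rightarrow> nat list" where
  "class_max X = (THE u. u \<in> X \<and> (\<forall>v\<in>X. m_perm_le u v \<longrightarrow> v = u))"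

definition metasylvester_le :: "nat list set \<Rightarrow> nat list set \<Rightarrow> bool" where
  "metasylvester_le X Y \<longleftrightarrow> m_perm_le (class_max X) (class_max Y)"

text \<open>The triple \<open>(a, b, i)\<close> encodes the couple \<open>(a, b\<^sub>i)\<close>.\<close>

definition tree_inversions :: "nat \<Rightarrow> nat \<Rightarrow> nat list set \<Rightarrow> (nat \<times> nat \<times> nat) set" where
  "tree_inversions m n X = {(a, b, i).
     1 \<le> a \<and> a < b \<and> b \<le> n \<and> 1 \<le> i \<and> i \<le> m \<and>
     (\<forall>k l. occurs_at (class_max X) b i k \<and> l < length (class_max X) \<and> class_max X ! l = a
        \<longrightarrow> k < l)}"

definition \<psi> :: "nat \<Rightarrow> nat \<Rightarrow> (nat \<Rightarrow> nat) list \<Rightarrow> nat list set" where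
  "\<psi> m n c = (THE X. X \<in> metasylvester_classes m n \<and>
     tree_inversions m n X =
       {(a, b, i). 1 \<le> i \<and> i \<le> m \<and> (a, b) \<in> coinv n (component c i)})"

definition chain_le :: "nat \<Rightarrow> nat \<Rightarrow> (nat \<Rightarrow> nat) list \<Rightarrow> (nat \<Rightarrow> nat) list \<Rightarrow> bool" where
  "chain_le m n c\<^sub>1 c\<^sub>2 \<longleftrightarrow> metasylvester_le (\<psi> m n c\<^sub>1) (\<psi> m n c\<^sub>2)"

end

theory Submission
  imports Defs
begin

text \<open>
  Each rewriting step exchanges two adjacent letters and adds one co-inversion, and a word to which
  no step applies has no subword \<open>a \<dots> b \<dots> a\<close> with \<open>a < b\<close>. In such a word, \<open>b\<^sub>j\<close> precedes
  one \<open>a\<close> iff it precedes the last one, so the word, its tree-inversions and the order are all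
  determined by the pairs with \<open>b\<^sub>j\<close> before the last \<open>a\<close>. A suitable closure of this set of pairs is
  constant on classes, which makes the irreducible word of a class unique and maximal.

  Conversely, a chain prescribes the relative order of any two occurrences of letters. The chain
  condition and the avoidance of 231 exclude 3-cycles, so sorting the occurrences gives an irreducible
  word with the prescribed tree-inversions; comparing classes is then comparing co-inversion sets.
\<close>

section \<open>Precedence in a word\<close>

text \<open>For distinct entries this is a strict linear order on the set of the list, which
  replaces most arguments about positions.\<close>

fun before :: "'a list \<Rightarrow> ('a \<times> 'a) set" where
  "before [] = {}"
| "before (x # xs) = {x} \<times> set xs \<union> before xs"

lemma before_append [simp]:
  "before (xs @ ys) = before xs \<union> before ys \<union> set xs \<times> set ys"
  by (induction xs) auto

lemma before_set: "(x, y) \<in> before xs \<Longrightarrow> x \<in> set xs \<and> y \<in> set xs"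
  by (induction xs) auto

lemma before_iff_nth:
  "(x, y) \<in> before xs \<longleftrightarrow> (\<exists>k l. k < l \<and> l < length xs \<and> xs ! k = x \<and> xs ! l = y)"
proof
  assume "(x, y) \<in> before xs"
  then show "\<exists>k l. k < l \<and> l < length xs \<and> xs ! k = x \<and> xs ! l = y"
  proof (induction xs)
    case (Cons z xs)
    then consider "z = x" "y \<in> set xs" | "(x, y) \<in> before xs" by auto
    then show ?case
    proof cases
      case 1
      then obtain l where "l < length xs" "xs ! l = y" by (auto simp: in_set_conv_nth)
      then have "0 < Suc l \<and> Suc l < length (z # xs) \<and> (z # xs) ! 0 = x \<and> (z # xs) ! Suc l = y"
        using 1 by simp
      then show ?thesis by blast
    next
      case 2
      then obtain k l where "k < l" "l < length xs" "xs ! k = x" "xs ! l = y"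
        using Cons.IH by blast
      then have "Suc k < Suc l \<and> Suc l < length (z # xs) \<and> (z # xs) ! Suc k = x
          \<and> (z # xs) ! Suc l = y"
        by simp
      then show ?thesis by blast
    qed
  qed simp
next
  assume "\<exists>k l. k < l \<and> l < length xs \<and> xs ! k = x \<and> xs ! l = y"
  then obtain k l where kl: "k < l" "l < length xs" "xs ! k = x" "xs ! l = y" by blast
  then have "x \<in> set (take l xs)"
    using nth_mem[of k "take l xs"] by simp
  moreover have "y \<in> set (drop l xs)"
    using kl by (metis Cons_nth_drop_Suc list.set_intros(1))
  ultimately have "(x, y) \<in> before (take l xs @ drop l xs)"
    unfolding before_append by blast
  then show "(x, y) \<in> before xs" by simp
qed

lemma before_split: "(x, y) \<in> before xs \<Longrightarrow> \<exists>p q r. xs = p @ x # q @ y # r"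
proof (induction xs)
  case (Cons z xs)
  then consider "z = x" "y \<in> set xs" | "(x, y) \<in> before xs" by auto
  then show ?case
  proof cases
    case 1
    then show ?thesis by (metis append_Nil split_list)
  next
    case 2
    then show ?thesis using Cons.IH by (metis append_Cons)
  qed
qed simp

text \<open>Distinctness makes both pairs refer to the same occurrence of \<open>y\<close>, so the
  two splittings merge.\<close>

lemma before_split3:
  assumes "distinct xs" "(x, y) \<in> before xs" "(y, z) \<in> before xs"
  shows "\<exists>p q r s. xs = p @ x # q @ y # r @ z # s"
proof -
  obtain p r s where xs: "xs = p @ y # r @ z # s" using before_split[OF assms(3)] by blast
  then have "x \<in> set p" using assms(1,2) by (auto dest: before_set)
  then obtain p' q where "p = p' @ x # q" by (meson split_list)
  then show ?thesis using xs by auto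
qed

lemma before_trans:
  "distinct xs \<Longrightarrow> (x, y) \<in> before xs \<Longrightarrow> (y, z) \<in> before xs \<Longrightarrow> (x, z) \<in> before xs"
  by (drule (2) before_split3) auto

lemma before_asym: "distinct xs \<Longrightarrow> (x, y) \<in> before xs \<Longrightarrow> (y, x) \<notin> before xs"
  by (induction xs) (auto dest: before_set)

lemma before_total:
  "x \<in> set xs \<Longrightarrow> y \<in> set xs \<Longrightarrow> x \<noteq> y \<Longrightarrow> (x, y) \<in> before xs \<or> (y, x) \<in> before xs"
  by (induction xs) auto

text \<open>Induction on the heads: a head \<open>x\<close> different from the head \<open>y\<close>
  of \<open>ys\<close> would have to precede \<open>y\<close> in \<open>ys\<close>.\<close>

lemma before_inject:
  "distinct xs \<Longrightarrow> distinct ys \<Longrightarrow> set xs = set ys \<Longrightarrow> before xs \<subseteq> before ys \<Longrightarrow> xs = ys"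
proof (induction xs arbitrary: ys)
  case (Cons x xs)
  from Cons.prems(3) obtain y zs where ys: "ys = y # zs" by (cases ys) auto
  have "x = y"
  proof (rule ccontr)
    assume "x \<noteq> y"
    then have "y \<in> set xs" using Cons.prems(3) ys by auto
    then have "(x, y) \<in> before ys" using Cons.prems(4) by auto
    then show False using \<open>x \<noteq> y\<close> Cons.prems(2) ys by (auto dest: before_set)
  qed
  have "set xs = set zs" using Cons.prems ys \<open>x = y\<close> by auto
  moreover have "before xs \<subseteq> before zs"
  proof
    fix e assume e: "e \<in> before xs"
    then have "fst e \<noteq> x" using Cons.prems(1) before_set[of "fst e" "snd e" xs] by auto
    then show "e \<in> before zs" using e Cons.prems(4) ys \<open>x = y\<close> by auto
  qed
  ultimately show ?case using Cons.IH[of zs] Cons.prems ys \<open>x = y\<close> by simp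
qed simp

section \<open>Sorting by a relation that is linear on a finite set\<close>

lemma sorted_wrt_before: "sorted_wrt r xs \<Longrightarrow> (x, y) \<in> before xs \<Longrightarrow> r x y"
  by (induction xs) auto

text \<open>Selection sort: a minimal element goes first. Linearity is asked only on
  \<open>A\<close>, since \<open>chain_rel\<close> is shown transitive only for occurrences with
  letters and indices in range.\<close>

lemma ex_sorted_wrt_list:
  assumes "finite A" "transp_on A r" "asymp_on A r" "totalp_on A r"
  shows "\<exists>xs. distinct xs \<and> set xs = A \<and> sorted_wrt r xs"
  using assms
proof (induction "card A" arbitrary: A)
  case (Suc k)
  then have "A \<noteq> {}" by auto
  then obtain x where x: "x \<in> A" "\<forall>y\<in>A. y \<noteq> x \<longrightarrow> \<not> r y x"
    using Finite_Set.bex_min_element[of A r] Suc.prems by blast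
  have "k = card (A - {x})" using Suc.hyps(2) x(1) Suc.prems(1) by simp
  moreover have "transp_on (A - {x}) r" "asymp_on (A - {x}) r" "totalp_on (A - {x}) r"
    using Suc.prems by (meson Diff_subset transp_on_subset asymp_on_subset totalp_on_subset)+
  ultimately obtain xs where xs: "distinct xs" "set xs = A - {x}" "sorted_wrt r xs"
    using Suc.hyps(1)[of "A - {x}"] Suc.prems(1) by auto
  have "\<forall>y\<in>set xs. r x y"
    using xs(2) x Suc.prems(4) unfolding totalp_on_def by blast
  then have "distinct (x # xs) \<and> set (x # xs) = A \<and> sorted_wrt r (x # xs)"
    using xs x(1) by auto
  then show ?case by blast
qed auto

section \<open>Words with numbered occurrences\<close>

text \<open>The occurrence \<open>b_i\<close> is encoded as \<open>(b, i)\<close>. All entries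
  become distinct, so \<open>before (lab w)\<close> is a linear order on occurrences.\<close>

definition lab :: "'a list \<Rightarrow> ('a \<times> nat) list" where
  "lab w = map (\<lambda>k. (w ! k, count_list (take (Suc k) w) (w ! k))) [0..<length w]"

lemma length_lab [simp]: "length (lab w) = length w"
  by (simp add: lab_def)

lemma nth_lab: "k < length w \<Longrightarrow> lab w ! k = (w ! k, count_list (take (Suc k) w) (w ! k))"
  by (simp add: lab_def)

lemma occurs_at_iff: "occurs_at w b i k \<longleftrightarrow> k < length w \<and> lab w ! k = (b, i)"
  by (auto simp: occurs_at_def nth_lab)

lemma map_fst_lab [simp]: "map fst (lab w) = w"
  by (rule nth_equalityI) (auto simp: nth_lab)

lemma lab_Nil [simp]: "lab [] = []"
  by (simp add: lab_def)

lemma lab_append: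
  "lab (u @ v) = lab u @ map (\<lambda>(b, i). (b, count_list u b + i)) (lab v)"
  by (rule nth_equalityI)
    (auto simp: nth_lab nth_append Suc_diff_le not_less split: prod.splits)

lemma lab_snoc [simp]: "lab (w @ [x]) = lab w @ [(x, Suc (count_list w x))]"
  by (simp add: lab_append) (simp add: lab_def)

lemma set_lab: "set (lab w) = {(a, i). 1 \<le> i \<and> i \<le> count_list w a}"
  by (induction w rule: rev_induct) (auto simp: le_Suc_eq split: if_splits)

lemma distinct_lab [simp]: "distinct (lab w)"
  by (induction w rule: rev_induct) (auto simp: set_lab)

lemma before_lab_same: "((a, i), (a, j)) \<in> before (lab w) \<Longrightarrow> i < j"
  by (induction w rule: rev_induct) (auto simp: set_lab)

lemma before_lab_same_iff:
  "((a, i), (a, j)) \<in> before (lab w) \<longleftrightarrow> 1 \<le> i \<and> i < j \<and> j \<le> count_list w a"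
proof
  assume *: "((a, i), (a, j)) \<in> before (lab w)"
  then show "1 \<le> i \<and> i < j \<and> j \<le> count_list w a"
    using before_lab_same[OF *] before_set[OF *] by (auto simp: set_lab)
next
  assume *: "1 \<le> i \<and> i < j \<and> j \<le> count_list w a"
  then have "((a, i), (a, j)) \<in> before (lab w) \<or> ((a, j), (a, i)) \<in> before (lab w)"
    by (intro before_total) (auto simp: set_lab)
  then show "((a, i), (a, j)) \<in> before (lab w)"
    using * before_lab_same by fastforce
qed

lemma set_lab_append_right:
  "set (map (\<lambda>(b, i). (b, count_list u b + i)) (lab v)) =
    {(b, i). count_list u b < i \<and> i \<le> count_list u b + count_list v b}"
proof -
  have "(b, i) \<in> (\<lambda>(b, i). (b, count_list u b + i)) ` set (lab v)"
    if "count_list u b < i" "i \<le> count_list u b + count_list v b" for b i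
    using that by (intro image_eqI[of _ _ "(b, i - count_list u b)"]) (auto simp: set_lab)
  then show ?thesis by (auto simp: set_lab)
qed

text \<open>Turns a sorted list of numbered occurrences back into a word. Removing the last entry
  keeps the shape, with \<open>f\<close> lowered by one at its letter.\<close>

lemma lab_map_fst:
  assumes "distinct L" "set L = {(a, i). 1 \<le> i \<and> i \<le> f a}"
    "\<And>a i j. ((a, i), (a, j)) \<in> before L \<Longrightarrow> i < j"
  shows "lab (map fst L) = L"
  using assms
proof (induction L arbitrary: f rule: rev_induct)
  case (snoc e L)
  obtain x i where e: "e = (x, i)" by force
  have lt: "j < i" if "(x, j) \<in> set L" for j
    using that snoc.prems(3)[of x j i] e by auto
  have i: "1 \<le> i" "i \<le> f x" using snoc.prems(2) e by auto
  have ifx: "i = f x"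
  proof (rule ccontr)
    \<comment> \<open>The pair \<open>(x, f x)\<close> would come before the last entry, so
      \<open>f x < i\<close>, contrary to \<open>i \<le> f x\<close>.\<close>
    assume "i \<noteq> f x"
    moreover have "(x, f x) \<in> set (L @ [e])" using snoc.prems(2) i by auto
    ultimately have "(x, f x) \<in> set L" using e by auto
    then show False using lt i by fastforce
  qed
  have setL: "set L = {(a, j). 1 \<le> j \<and> j \<le> (f(x := i - 1)) a}"
  proof -
    have "set L = set (L @ [e]) - {e}" using snoc.prems(1) by auto
    also have "\<dots> = {(a, j). 1 \<le> j \<and> j \<le> f a} - {(x, f x)}"
      unfolding snoc.prems(2) unfolding e ifx ..
    also have "\<dots> = {(a, j). 1 \<le> j \<and> j \<le> (f(x := i - 1)) a}"
      unfolding ifx by (auto split: if_splits)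
    finally show ?thesis .
  qed
  have IH: "lab (map fst L) = L"
    by (rule snoc.IH[OF _ setL]) (use snoc.prems(1,3) in auto)
  have "(x, j) \<in> set L \<longleftrightarrow> 1 \<le> j \<and> j \<le> count_list (map fst L) x" for j
    unfolding set_lab[of "map fst L", unfolded IH] by simp
  then have "1 \<le> j \<and> j \<le> i - 1 \<longleftrightarrow> 1 \<le> j \<and> j \<le> count_list (map fst L) x" for j
    unfolding setL by simp
  \<comment> \<open>The instances at the two upper bounds give the two inequalities.\<close>
  from this[of "i - 1"] this[of "count_list (map fst L) x"]
  have "count_list (map fst L) x = i - 1"
    by linarith
  then show ?case using IH e i by simp
qed simp

section \<open>Co-inversions and letter multiplicities\<close>

lemma m_coinv_iff:
  "((a, i), (b, j)) \<in> m_coinv w \<longleftrightarrow> a < b \<and> ((b, j), (a, i)) \<in> before (lab w)"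
  unfolding m_coinv_def occurs_at_iff before_iff_nth
  by (simp, metis less_trans)

lemma count_list_eq_count: "count_list w a = count (mset w) a"
  by (induction w) auto

lemma m_permutations_iff:
  "w \<in> m_permutations m n \<longleftrightarrow> (\<forall>a. count_list w a = (if a \<in> {1..n} then m else 0))"
proof -
  have "count (\<Sum>a\<in>{1..n}. replicate_mset m a) x = (if x \<in> {1..n} then m else 0)" for x
    by (simp add: count_sum sum.delta cong: if_cong)
  then show ?thesis
    by (simp add: m_permutations_def permutations_of_multiset_def multiset_eq_iff
        count_list_eq_count)
qed

lemma set_lab_m_permutation:
  "w \<in> m_permutations m n \<Longrightarrow> set (lab w) = {1..n} \<times> {1..m}"
  by (auto simp: set_lab m_permutations_iff split: if_splits)

text \<open>Every pair of occurrences is decided: equal letters by their indices, distinct ones by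
  whether they form a co-inversion.\<close>

lemma m_coinv_antisym:
  assumes "u \<in> m_permutations m n" "v \<in> m_permutations m n" "m_coinv u = m_coinv v"
  shows "u = v"
proof -
  have "before (lab u) \<subseteq> before (lab v)"
  proof clarify
    fix a i b j assume *: "((a, i), (b, j)) \<in> before (lab u)"
    then have s: "(a, i) \<in> set (lab v)" "(b, j) \<in> set (lab v)" "(a, i) \<noteq> (b, j)"
      using before_set[OF *] before_asym[OF distinct_lab *] assms
      by (auto simp: set_lab_m_permutation)
    consider "a = b" | "b < a" | "a < b" by linarith
    then show "((a, i), (b, j)) \<in> before (lab v)"
    proof cases
      case 1
      then show ?thesis
        using before_lab_same[of a i j u] * s by (auto simp: before_lab_same_iff set_lab)
    next
      case 2
      then show ?thesis using * assms(3) by (metis m_coinv_iff)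
    next
      case 3
      then have "((b, j), (a, i)) \<notin> before (lab v)"
        using before_asym[OF distinct_lab *] assms(3) by (metis m_coinv_iff)
      then show ?thesis using before_total[OF s] by blast
    qed
  qed
  then have "lab u = lab v"
    using before_inject[OF distinct_lab distinct_lab] assms(1,2) by (metis set_lab_m_permutation)
  then show ?thesis by (metis map_fst_lab)
qed

section \<open>Rewriting to the maximal element\<close>

text \<open>The counts before and after the two positions are the same for both words, so only two
  neighbouring labels trade places. The set of \<open>Q\<close> serves to locate later occurrences
  in \<open>closure_inv_step\<close>.\<close>

lemma lab_swap:
  assumes "x \<noteq> y"
  shows "\<exists>Q. lab (p @ [x, y] @ q) = lab p @ [(x, Suc (count_list p x)), (y, Suc (count_list p y))] @ Q
    \<and> lab (p @ [y, x] @ q) = lab p @ [(y, Suc (count_list p y)), (x, Suc (count_list p x))] @ Q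
    \<and> set Q = {(b, i). count_list (p @ [x, y]) b < i \<and> i \<le> count_list (p @ [x, y] @ q) b}"
proof -
  let ?Q = "map (\<lambda>(b, i). (b, count_list (p @ [x, y]) b + i)) (lab q)"
  have *: "lab [x, y] = [(x, 1), (y, 1)]" "lab [y, x] = [(y, 1), (x, 1)]"
    using assms by (auto simp: lab_def upt_rec)
  have "(\<lambda>(b, i). (b, count_list (p @ [x, y]) b + i)) = (\<lambda>(b, i). (b, count_list (p @ [y, x]) b + i))"
    by (auto simp: fun_eq_iff)
  then have "lab ((p @ [x, y]) @ q) = lab (p @ [x, y]) @ ?Q" "lab ((p @ [y, x]) @ q) = lab (p @ [y, x]) @ ?Q"
    by (simp_all only: lab_append)
  moreover have "lab (p @ [x, y]) = lab p @ [(x, Suc (count_list p x)), (y, Suc (count_list p y))]"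
    "lab (p @ [y, x]) = lab p @ [(y, Suc (count_list p y)), (x, Suc (count_list p x))]"
    by (simp_all only: lab_append *) simp_all
  moreover have "set ?Q = {(b, i). count_list (p @ [x, y]) b < i \<and> i \<le> count_list (p @ [x, y] @ q) b}"
    by (subst set_lab_append_right) (auto simp: add.assoc)
  ultimately show ?thesis by (intro exI[of _ ?Q]) simp
qed

lemma m_coinv_swap:
  assumes "x < y"
  shows "m_coinv (p @ [y, x] @ q) =
    insert ((x, Suc (count_list p x)), (y, Suc (count_list p y))) (m_coinv (p @ [x, y] @ q))"
    and "((x, Suc (count_list p x)), (y, Suc (count_list p y))) \<notin> m_coinv (p @ [x, y] @ q)"
proof -
  obtain Q where Q: "lab (p @ [x, y] @ q) = lab p @ [(x, Suc (count_list p x)), (y, Suc (count_list p y))] @ Q"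
    "lab (p @ [y, x] @ q) = lab p @ [(y, Suc (count_list p y)), (x, Suc (count_list p x))] @ Q"
    using lab_swap[of x y p q] assms by blast
  have "((a, i), (b, j)) \<in> m_coinv (p @ [y, x] @ q) \<longleftrightarrow> ((a, i), (b, j)) \<in>
      insert ((x, Suc (count_list p x)), (y, Suc (count_list p y))) (m_coinv (p @ [x, y] @ q))"
    for a i b j
    unfolding insert_iff m_coinv_iff Q using assms by auto
  then show "m_coinv (p @ [y, x] @ q) =
      insert ((x, Suc (count_list p x)), (y, Suc (count_list p y))) (m_coinv (p @ [x, y] @ q))"
    by (auto simp only: set_eq_iff split_paired_All)
  have "((x, Suc (count_list p x)), (y, Suc (count_list p y))) \<in> before (lab (p @ [x, y] @ q))"
    unfolding Q by simp
  then show "((x, Suc (count_list p x)), (y, Suc (count_list p y))) \<notin> m_coinv (p @ [x, y] @ q)"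
    unfolding m_coinv_iff using before_asym[OF distinct_lab] by blast
qed

section \<open>Rewriting steps and irreducible words\<close>

lemma metasylvester_step_swap:
  assumes "metasylvester_step u v"
  obtains p x y q where "x < y" "u = p @ [x, y] @ q" "v = p @ [y, x] @ q"
  using assms
proof cases
  case (1 a c p v w)
  then show ?thesis using that[of a c p "v @ [a] @ w"] by simp
next
  case (2 a b c p v w x)
  then show ?thesis using that[of a c "p @ [b] @ v" "w @ [b] @ x"] by simp
qed

lemma metasylvester_step_count_list: "metasylvester_step u v \<Longrightarrow> count_list u a = count_list v a"
  by (erule metasylvester_step_swap) simp

lemma metasylvester_step_m_permutations:
  "metasylvester_step u v \<Longrightarrow> u \<in> m_permutations m n \<longleftrightarrow> v \<in> m_permutations m n"
  by (simp add: m_permutations_iff metasylvester_step_count_list)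

lemma metasylvester_step_m_coinv: "metasylvester_step u v \<Longrightarrow> m_coinv u \<subset> m_coinv v"
  by (erule metasylvester_step_swap) (use m_coinv_swap in blast)

text \<open>The shape of irreducible words, stated on labels; \<open>i < k\<close> is automatic,
  since the occurrences of a letter appear in index order.\<close>

definition avoids_aba :: "nat list \<Rightarrow> bool" where
  "avoids_aba w \<longleftrightarrow> (\<forall>a i b j k. ((a, i), (b, j)) \<in> before (lab w) \<and>
     ((b, j), (a, k)) \<in> before (lab w) \<longrightarrow> b \<le> a)"

text \<open>
  Between two letters \<open>a\<close> enclosing a larger one, let \<open>y\<close> be the first letter above \<open>a\<close>:
  the letter just before \<open>y\<close> is \<open>a\<close> (first rule) or smaller (second rule).
\<close>
lemma ex_metasylvester_step:
  assumes "\<not> avoids_aba w"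
  shows "\<exists>v. metasylvester_step w v"
proof -
  obtain a i b j k where ab: "a < b" "((a, i), (b, j)) \<in> before (lab w)"
      "((b, j), (a, k)) \<in> before (lab w)"
    using assms unfolding avoids_aba_def by (metis not_le)
  obtain P Q R S where "lab w = P @ (a, i) # Q @ (b, j) # R @ (a, k) # S"
    using before_split3[OF distinct_lab ab(2,3)] by blast
  then have "map fst (lab w) = map fst P @ a # (map fst Q @ b # map fst R) @ a # map fst S" by simp
  then obtain p s r where w: "w = p @ a # s @ a # r" "b \<in> set s"
    unfolding map_fst_lab by fastforce
  then obtain s1 y s2 where s: "s = s1 @ y # s2" "a < y" "\<forall>z\<in>set s1. \<not> a < z"
    using split_list_first_prop[of s "\<lambda>z. a < z"] ab(1) by blast
  show ?thesis
  proof (cases "s1 = [] \<or> last s1 = a")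
    case True
    then obtain p' where "p @ a # s1 = p' @ [a]"
      by (metis append_butlast_last_id append_Cons append_assoc)
    then have "w = p' @ [a, y] @ s2 @ [a] @ r" using w s
      by (metis append.assoc append_Cons append_Nil)
    then show ?thesis using metasylvester_step.intros(1)[OF s(2)] by blast
  next
    case False
    then obtain s0 x where x: "s1 = s0 @ [x]" by (metis rev_exhaust)
    then have "x < a" using s(3) False by auto
    moreover have "w = p @ [a] @ s0 @ [x, y] @ s2 @ [a] @ r" using w s x by simp
    ultimately show ?thesis using metasylvester_step.intros(2)[OF _ s(2)] by blast
  qed
qed

text \<open>Rewriting terminates, because the co-inversions grow strictly inside the finite set
  \<open>?S\<close>.\<close>

lemma ex_avoids_aba:
  assumes "u \<in> m_permutations m n"
  shows "\<exists>v. metasylvester_step\<^sup>*\<^sup>* u v \<and> m_coinv u \<subseteq> m_coinv v \<and> v \<in> m_permutations m n \<and> avoids_aba v"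
proof -
  let ?S = "({1..n} \<times> {1..m}) \<times> ({1..n} \<times> {1..m})"
  have sub: "m_coinv u \<subseteq> ?S" if "u \<in> m_permutations m n" for u
    using set_lab_m_permutation[OF that] by (auto simp: m_coinv_iff dest!: before_set)
  show ?thesis
    using assms
  proof (induction "card (?S - m_coinv u)" arbitrary: u rule: less_induct)
    case less
    show ?case
    proof (cases "avoids_aba u")
      case False
      then obtain u' where u': "metasylvester_step u u'" using ex_metasylvester_step by blast
      then have p: "u' \<in> m_permutations m n" using less.prems metasylvester_step_m_permutations by blast
      have c: "m_coinv u \<subset> m_coinv u'" using u' metasylvester_step_m_coinv by blast
      have "card (?S - m_coinv u') < card (?S - m_coinv u)"
        using c sub[OF p] by (intro psubset_card_mono) auto
      from less.hyps[OF this p] obtain v where "metasylvester_step\<^sup>*\<^sup>* u' v" "m_coinv u' \<subseteq> m_coinv v"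
          "v \<in> m_permutations m n" "avoids_aba v" by blast
      then show ?thesis using u' c by (meson converse_rtranclp_into_rtranclp order_trans psubset_imp_subset)
    qed (use less.prems in blast)
  qed
qed

section \<open>An invariant of the congruence\<close>

text \<open>In an \<open>m\<close>-permutation \<open>(a, m)\<close> is the last \<open>a\<close>.
  The larger letter comes first here, unlike in \<open>tree_inversions\<close>.\<close>

definition last_inv :: "nat \<Rightarrow> nat list \<Rightarrow> (nat \<times> nat \<times> nat) set" where
  "last_inv m w = {(b, j, a). a < b \<and> ((b, j), (a, m)) \<in> before (lab w)}"

text \<open>
  The second rule can move \<open>c\<^sub>j\<close> before the last \<open>a\<close>. Then both words have \<open>c\<^sub>j\<close> before the last \<open>b\<close>
  and \<open>b\<^sub>1\<close> before the last \<open>a\<close>, so the new pair already lies in the closure below.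
\<close>
inductive closure_inv :: "(nat \<times> nat \<times> nat) set \<Rightarrow> nat \<Rightarrow> nat \<Rightarrow> nat \<Rightarrow> bool" for S where
  base: "(b, j, a) \<in> S \<Longrightarrow> closure_inv S b j a"
| trans: "closure_inv S c j b \<Longrightarrow> closure_inv S b 1 a \<Longrightarrow> closure_inv S c j a"

lemma closure_inv_mono:
  "closure_inv S b j a \<Longrightarrow> (\<And>b j a. (b, j, a) \<in> S \<Longrightarrow> closure_inv T b j a) \<Longrightarrow> closure_inv T b j a"
  by (induction rule: closure_inv.induct) (auto intro: closure_inv.trans)

lemma last_inv_iff: "(b, j, a) \<in> last_inv m w \<longleftrightarrow> ((a, m), (b, j)) \<in> m_coinv w"
  by (auto simp: last_inv_def m_coinv_iff)

text \<open>Co-inversions only grow, so one inclusion is immediate. For the other, only the single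
  co-inversion created by the swap has to be derived.\<close>

lemma closure_inv_step:
  assumes "metasylvester_step u v" "u \<in> m_permutations m n"
  shows "closure_inv (last_inv m u) = closure_inv (last_inv m v)"
proof -
  have "closure_inv (last_inv m u) b j a" if "(b, j, a) \<in> last_inv m v" for b j a
    using assms(1)
  proof cases
    case (1 x y p s r)
    have m: "count_list u x = m"
      using assms(2) 1 by (auto simp: m_permutations_iff split: if_splits)
    \<comment> \<open>A further \<open>x\<close> follows the swapped pair, so the moved
      \<open>x\<close> has an index below \<open>m\<close>.\<close>
    have "((x, Suc (count_list p x)), (y, Suc (count_list p y))) \<noteq> ((a, m), (b, j))"
      using 1 m by auto
    then have "((a, m), (b, j)) \<in> m_coinv u"
      using m_coinv_swap(1)[OF 1(3), of p "s @ [x] @ r"] that 1 unfolding last_inv_iff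
      by (metis append_Cons append_Nil insert_iff)
    then show ?thesis by (simp add: last_inv_iff closure_inv.base)
  next
    case (2 x z y p s q r)
    have m: "count_list u z = m" "count_list u x = m"
      using assms(2) 2 by (auto simp: m_permutations_iff split: if_splits)
    let ?p = "p @ [z] @ s"
    let ?X = "(x, Suc (count_list ?p x))" and ?Y = "(y, Suc (count_list ?p y))"
    have "((a, m), (b, j)) = (?X, ?Y) \<or> ((a, m), (b, j)) \<in> m_coinv u"
      using m_coinv_swap(1)[of x y ?p "q @ [z] @ r"] that 2 unfolding last_inv_iff by auto
    then show ?thesis
    proof
      \<comment> \<open>Here \<open>x < z < y\<close> are the letters of the second rule, and the
        new pair concerns the last \<open>x\<close>.\<close>
      assume e: "((a, m), (b, j)) = (?X, ?Y)"
      have "x \<noteq> y" using 2 by simp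
      then obtain Q where Q: "lab u = lab ?p @ [?X, ?Y] @ Q"
         "set Q = {(b, i). count_list (?p @ [x, y]) b < i \<and> i \<le> count_list (?p @ [x, y] @ q @ [z] @ r) b}"
        using lab_swap[of x y ?p "q @ [z] @ r"] 2 by auto
      \<comment> \<open>\<open>Q\<close> carries the occurrences after the swapped pair. A
        \<open>z\<close> follows, so the last \<open>z\<close> lies in \<open>Q\<close>; likewise
        the \<open>z\<close> on the left puts the first one into the prefix.\<close>
      have "(z, m) \<in> set Q" unfolding Q(2) using m 2 by auto
      then have "(?Y, (z, m)) \<in> before (lab u)" unfolding Q(1) by simp
      then have 1: "(b, j, z) \<in> last_inv m u" using e 2 by (simp add: last_inv_def)
      have "(z, 1) \<in> set (lab ?p)" unfolding set_lab by auto
      then have "((z, 1), ?X) \<in> before (lab u)" unfolding Q(1) by simp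
      then have "(z, 1, a) \<in> last_inv m u" using e 2 by (simp add: last_inv_def)
      with 1 show ?thesis by (meson closure_inv.intros)
    next
      assume "((a, m), (b, j)) \<in> m_coinv u"
      then show ?thesis by (simp add: last_inv_iff closure_inv.base)
    qed
  qed
  moreover have "closure_inv (last_inv m v) b j a" if "(b, j, a) \<in> last_inv m u" for b j a
    using metasylvester_step_m_coinv[OF assms(1)] that unfolding last_inv_iff[symmetric]
    by (meson closure_inv.base last_inv_iff psubset_imp_subset subsetD)
  ultimately show ?thesis
    by (intro ext iffI) (blast intro: closure_inv_mono)+
qed

lemma equivclp_metasylvester_step:
  assumes "equivclp metasylvester_step u v" "u \<in> m_permutations m n"
  shows "v \<in> m_permutations m n \<and> closure_inv (last_inv m u) = closure_inv (last_inv m v)"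
  using assms
proof (induction rule: equivclp_induct)
  case (step y z)
  then show ?case
    by (metis closure_inv_step metasylvester_step_m_permutations)
qed simp

lemma avoids_aba_m_coinv_iff:
  assumes "w \<in> m_permutations m n" "avoids_aba w"
  shows "((a, i), (b, j)) \<in> m_coinv w \<longleftrightarrow> 1 \<le> i \<and> i \<le> m \<and> (b, j, a) \<in> last_inv m w"
proof
  assume "((a, i), (b, j)) \<in> m_coinv w"
  then have *: "a < b" "((b, j), (a, i)) \<in> before (lab w)" by (auto simp: m_coinv_iff)
  then have i: "1 \<le> i" "i \<le> m" "a \<in> {1..n}"
    using before_set[OF *(2)] set_lab_m_permutation[OF assms(1)] by auto
  moreover have "((b, j), (a, m)) \<in> before (lab w)"
  proof (cases "i = m")
    case False
    then have "((a, i), (a, m)) \<in> before (lab w)"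
      using i assms(1) by (simp add: before_lab_same_iff m_permutations_iff)
    then show ?thesis using * before_trans[OF distinct_lab] by blast
  qed (use * in simp)
  ultimately show "1 \<le> i \<and> i \<le> m \<and> (b, j, a) \<in> last_inv m w" using * by (simp add: last_inv_def)
next
  assume *: "1 \<le> i \<and> i \<le> m \<and> (b, j, a) \<in> last_inv m w"
  then have l: "a < b" "((b, j), (a, m)) \<in> before (lab w)" by (auto simp: last_inv_def)
  \<comment> \<open>Otherwise \<open>(a, i)\<close>, \<open>(b, j)\<close>, \<open>(a, m)\<close>
    would be a forbidden subword.\<close>
  then have "\<not> ((a, i), (b, j)) \<in> before (lab w)"
    using assms(2) unfolding avoids_aba_def by fastforce
  moreover have "(a, i) \<in> set (lab w)" "(b, j) \<in> set (lab w)"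
    using before_set[OF l(2)] * set_lab_m_permutation[OF assms(1)] by auto
  ultimately show "((a, i), (b, j)) \<in> m_coinv w"
    using l(1) before_total[of "(a, i)" "lab w" "(b, j)"] by (auto simp: m_coinv_iff)
qed

text \<open>Without the pattern, a \<open>c\<close> before the last \<open>b\<close> is before the
  first \<open>b\<close>, which precedes the last \<open>a\<close>. So nothing new is generated, and
  the class invariant reveals \<open>last_inv\<close>.\<close>

lemma avoids_aba_closure_inv:
  assumes "w \<in> m_permutations m n" "avoids_aba w"
  shows "closure_inv (last_inv m w) b j a \<longleftrightarrow> (b, j, a) \<in> last_inv m w"
proof
  assume "closure_inv (last_inv m w) b j a"
  then show "(b, j, a) \<in> last_inv m w"
  proof (induction rule: closure_inv.induct)
    case (trans c j b a)
    then have "b \<in> {1..n} \<and> 1 \<le> m"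
      using before_set[of "(b, 1)" "(a, m)" "lab w"] set_lab_m_permutation[OF assms(1)]
      by (auto simp: last_inv_def)
    then have "((b, 1), (c, j)) \<in> m_coinv w"
      using avoids_aba_m_coinv_iff[OF assms] trans by simp
    then have "((c, j), (b, 1)) \<in> before (lab w)" by (simp add: m_coinv_iff)
    then show ?case using trans before_trans[OF distinct_lab] by (auto simp: last_inv_def)
  qed
qed (rule closure_inv.base)

section \<open>Comparison of irreducible words through their last inversions\<close>

lemma last_inv_subset_iff:
  assumes "u \<in> m_permutations m n" "avoids_aba u" "v \<in> m_permutations m n" "avoids_aba v" "1 \<le> m"
  shows "m_perm_le u v \<longleftrightarrow> last_inv m u \<subseteq> last_inv m v"
proof
  assume "m_perm_le u v"
  then show "last_inv m u \<subseteq> last_inv m v" by (auto simp: m_perm_le_def last_inv_iff)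
next
  assume "last_inv m u \<subseteq> last_inv m v"
  then show "m_perm_le u v"
    unfolding m_perm_le_def
    by (auto simp: avoids_aba_m_coinv_iff[OF assms(1,2)] avoids_aba_m_coinv_iff[OF assms(3,4)])
qed

lemma last_inv_inject:
  assumes "u \<in> m_permutations m n" "avoids_aba u" "v \<in> m_permutations m n" "avoids_aba v" "1 \<le> m"
    "last_inv m u = last_inv m v"
  shows "u = v"
  using last_inv_subset_iff[OF assms(1-5)] last_inv_subset_iff[OF assms(3,4,1,2,5)] assms(6)
    m_coinv_antisym[OF assms(1,3)]
  unfolding m_perm_le_def by blast

section \<open>Classes and tree-inversions\<close>

lemma equiv_metasylvester_cong: "equiv (m_permutations m n) (metasylvester_cong m n)"
proof (rule equivI)
  show "sym (metasylvester_cong m n)"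
    by (auto simp: sym_def metasylvester_cong_def intro: equivclp_sym)
  show "trans (metasylvester_cong m n)"
    by (auto simp: trans_def metasylvester_cong_def intro: equivclp_trans)
qed (auto simp: refl_on_def metasylvester_cong_def)

definition class_of :: "nat \<Rightarrow> nat \<Rightarrow> nat list \<Rightarrow> nat list set" where
  "class_of m n w = metasylvester_cong m n `` {w}"

text \<open>Any \<open>v\<close> in the class rewrites upwards to an irreducible word, which shares
  the invariant of \<open>w\<close> and hence equals \<open>w\<close>. Thus \<open>w\<close> is the
  greatest element and the only maximal one.\<close>

lemma class_max_class_of:
  assumes "w \<in> m_permutations m n" "avoids_aba w" "1 \<le> m"
  shows "class_max (class_of m n w) = w"
proof -
  have in_iff: "v \<in> class_of m n w \<longleftrightarrow> equivclp metasylvester_step w v" for v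
    using assms(1) equivclp_metasylvester_step[of w v m n]
    by (auto simp: class_of_def metasylvester_cong_def)
  have le: "m_perm_le v w" "v \<in> m_permutations m n" if v: "equivclp metasylvester_step w v" for v
  proof -
    show vp: "v \<in> m_permutations m n" using equivclp_metasylvester_step[OF v assms(1)] by simp
    then obtain v' where v': "metasylvester_step\<^sup>*\<^sup>* v v'" "m_coinv v \<subseteq> m_coinv v'"
        "v' \<in> m_permutations m n" "avoids_aba v'"
      using ex_avoids_aba by blast
    have "equivclp metasylvester_step w v'"
      using v v'(1) by (meson equivclp_trans rtranclp_into_equivclp)
    from equivclp_metasylvester_step[OF this assms(1)]
    have "last_inv m w = last_inv m v'"
      using avoids_aba_closure_inv[OF assms(1,2)] avoids_aba_closure_inv[OF v'(3,4)] by auto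
    then have "w = v'" using last_inv_inject assms v' by blast
    then show "m_perm_le v w" using v'(2) by (simp add: m_perm_le_def)
  qed
  have anti: "v = w" if "equivclp metasylvester_step w v" "m_perm_le w v" for v
    using le[OF that(1)] that(2) m_coinv_antisym[OF _ assms(1)] unfolding m_perm_le_def by blast
  have ww: "equivclp metasylvester_step w w" by simp
  show ?thesis
    unfolding class_max_def
  proof (rule the_equality)
    show "w \<in> class_of m n w \<and> (\<forall>v\<in>class_of m n w. m_perm_le w v \<longrightarrow> v = w)"
      using anti ww in_iff by auto
  next
    fix u assume "u \<in> class_of m n w \<and> (\<forall>v\<in>class_of m n w. m_perm_le u v \<longrightarrow> v = u)"
    then show "u = w" using le ww in_iff by blast
  qed
qed

lemma metasylvester_class_cases:
  assumes "X \<in> metasylvester_classes m n"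
  obtains w where "w \<in> m_permutations m n" "avoids_aba w" "X = class_of m n w"
proof -
  obtain u where u: "u \<in> m_permutations m n" "X = class_of m n u"
    using assms by (auto simp: metasylvester_classes_def quotient_def class_of_def)
  then obtain w where w: "metasylvester_step\<^sup>*\<^sup>* u w" "w \<in> m_permutations m n" "avoids_aba w"
    using ex_avoids_aba by blast
  then have "(u, w) \<in> metasylvester_cong m n"
    using u(1) by (simp add: metasylvester_cong_def rtranclp_into_equivclp)
  then have "X = class_of m n w"
    unfolding u(2) class_of_def by (rule equiv_class_eq[OF equiv_metasylvester_cong])
  then show ?thesis using that w by blast
qed

text \<open>Preceding all \<open>a\<close> includes preceding the last one; the converse is
  \<open>avoids_aba_m_coinv_iff\<close>.\<close>

lemma tree_inversions_class_of:
  assumes "w \<in> m_permutations m n" "avoids_aba w" "1 \<le> m"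
  shows "tree_inversions m n (class_of m n w) = {(a, b, i). (b, i, a) \<in> last_inv m w}"
proof -
  have "(a, b, i) \<in> tree_inversions m n (class_of m n w) \<longleftrightarrow> (b, i, a) \<in> last_inv m w" for a b i
  proof
    assume "(a, b, i) \<in> tree_inversions m n (class_of m n w)"
    then have r: "1 \<le> a" "a < b" "b \<le> n" "1 \<le> i" "i \<le> m" and
      t: "\<And>k l. occurs_at w b i k \<Longrightarrow> l < length w \<Longrightarrow> w ! l = a \<Longrightarrow> k < l"
      by (auto simp: tree_inversions_def class_max_class_of[OF assms])
    have "(b, i) \<in> set (lab w)" "(a, m) \<in> set (lab w)"
      using r assms(3) set_lab_m_permutation[OF assms(1)] by auto
    then obtain k l where k: "k < length w" "lab w ! k = (b, i)" and l: "l < length w" "lab w ! l = (a, m)"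
      by (auto simp: in_set_conv_nth)
    then have "k < l" using t[of k l] by (auto simp: occurs_at_iff nth_lab)
    then have "((b, i), (a, m)) \<in> before (lab w)" using k l by (auto simp: before_iff_nth)
    then show "(b, i, a) \<in> last_inv m w" using r by (simp add: last_inv_def)
  next
    assume L: "(b, i, a) \<in> last_inv m w"
    then have *: "a < b" "((b, i), (a, m)) \<in> before (lab w)" by (auto simp: last_inv_def)
    have r: "1 \<le> a" "b \<le> n" "1 \<le> i" "i \<le> m"
      using before_set[OF *(2)] set_lab_m_permutation[OF assms(1)] by auto
    have "k < l" if k: "occurs_at w b i k" and l: "l < length w" "w ! l = a" for k l
    proof -
      obtain i' where i': "lab w ! l = (a, i')" using l by (simp add: nth_lab)
      then have "(a, i') \<in> set (lab w)" using l by (metis length_lab nth_mem)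
      then have "1 \<le> i' \<and> i' \<le> m" using set_lab_m_permutation[OF assms(1)] by auto
      then have "((a, i'), (b, i)) \<in> m_coinv w" using L avoids_aba_m_coinv_iff[OF assms(1,2)] by blast
      then obtain k' l' where "k' < l'" "l' < length w" "lab w ! k' = (b, i)" "lab w ! l' = (a, i')"
        by (auto simp: m_coinv_iff before_iff_nth)
      moreover from this have "k' = k" "l' = l"
        using k l(1) i' nth_eq_iff_index_eq[OF distinct_lab, of _ w]
        unfolding occurs_at_iff by (metis length_lab less_trans)+
      ultimately show ?thesis by simp
    qed
    then show "(a, b, i) \<in> tree_inversions m n (class_of m n w)"
      using r * by (auto simp: tree_inversions_def class_max_class_of[OF assms])
  qed
  then show ?thesis by auto
qed

section \<open>The word of a chain\<close>

text \<open>\<open>inv \<sigma> a\<close> is the position of the letter \<open>a\<close> in the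
  word.\<close>

lemma coinv_iff_inv:
  assumes "\<sigma> permutes {1..n}"
  shows "(a, b) \<in> coinv n \<sigma> \<longleftrightarrow> a \<in> {1..n} \<and> b \<in> {1..n} \<and> a < b \<and> inv \<sigma> b < inv \<sigma> a"
proof
  assume "(a, b) \<in> coinv n \<sigma>"
  then obtain k l where kl: "a < b" "1 \<le> k" "k < l" "l \<le> n" "\<sigma> k = b" "\<sigma> l = a"
    by (auto simp: coinv_def)
  then have "inv \<sigma> b = k" "inv \<sigma> a = l" "a \<in> {1..n}" "b \<in> {1..n}"
    using permutes_inverses(2)[OF assms] permutes_in_image[OF assms, of k]
      permutes_in_image[OF assms, of l] by auto
  then show "a \<in> {1..n} \<and> b \<in> {1..n} \<and> a < b \<and> inv \<sigma> b < inv \<sigma> a" using kl by simp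
next
  assume *: "a \<in> {1..n} \<and> b \<in> {1..n} \<and> a < b \<and> inv \<sigma> b < inv \<sigma> a"
  have "inv \<sigma> a \<in> {1..n}" "inv \<sigma> b \<in> {1..n}"
    using * permutes_in_image[OF permutes_inv[OF assms]] by blast+
  then show "(a, b) \<in> coinv n \<sigma>"
    using * permutes_inverses(1)[OF assms] by (auto simp: coinv_def intro!: exI[of _ "inv \<sigma> _"])
qed

lemma metasylvester_chain_antimono:
  assumes "metasylvester_chain m n c" "1 \<le> i" "i \<le> j" "j \<le> m"
  shows "coinv n (component c j) \<subseteq> coinv n (component c i)"
  using assms(3,4)
proof (induction j rule: dec_induct)
  case (step k)
  then have "right_weak_le n (component c (k + 1)) (component c k)"
    using assms(1,2) by (simp add: metasylvester_chain_def)
  then show ?case using step by (auto simp: right_weak_le_def)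
qed simp

text \<open>The composition sends the position of a letter in \<open>component c i\<close> to its
  position in \<open>component c j\<close>. Letters read as \<open>y z x\<close> in the first and as
  \<open>x y z\<close> in the second would form 231.\<close>

lemma metasylvester_chain_avoids:
  assumes "metasylvester_chain m n c" "1 \<le> i" "i < j" "j \<le> m"
    and "x \<in> {1..n}" "y \<in> {1..n}" "z \<in> {1..n}"
    and "inv (component c i) y < inv (component c i) z" "inv (component c i) z < inv (component c i) x"
  shows "\<not> (inv (component c j) x < inv (component c j) y \<and> inv (component c j) y < inv (component c j) z)"
proof
  assume *: "inv (component c j) x < inv (component c j) y \<and> inv (component c j) y < inv (component c j) z"
  let ?s = "component c i" and ?t = "component c j"
  have p: "?s permutes {1..n}" and a: "avoids_231 n (inv ?t \<circ> ?s)"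
    using assms(1-4) by (auto simp: metasylvester_chain_def)
  have "inv ?s y \<in> {1..n}" "inv ?s x \<in> {1..n}"
    using permutes_in_image[OF permutes_inv[OF p]] assms by blast+
  then have "1 \<le> inv ?s y \<and> inv ?s y < inv ?s z \<and> inv ?s z < inv ?s x \<and> inv ?s x \<le> n
      \<and> (inv ?t \<circ> ?s) (inv ?s x) < (inv ?t \<circ> ?s) (inv ?s y)
      \<and> (inv ?t \<circ> ?s) (inv ?s y) < (inv ?t \<circ> ?s) (inv ?s z)"
    using * assms(8,9) by (simp add: permutes_inverses(1)[OF p])
  then show False using a unfolding avoids_231_def by blast
qed

text \<open>The prescribed order of occurrences: for distinct letters, the index of the larger one
  selects the permutation that decides.\<close>

definition chain_rel :: "nat \<Rightarrow> (nat \<Rightarrow> nat) list \<Rightarrow> nat \<times> nat \<Rightarrow> nat \<times> nat \<Rightarrow> bool" where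
  "chain_rel n c = (\<lambda>(x, i) (y, j). x = y \<and> i < j
     \<or> x < y \<and> (x, y) \<notin> coinv n (component c j)
     \<or> y < x \<and> (y, x) \<in> coinv n (component c i))"

text \<open>
  A 3-cycle on letters \<open>a < b < c\<close> with \<open>b\<^sub>j\<close>, \<open>c\<^sub>k\<close> forces \<open>j \<noteq> k\<close> and produces a pattern 231 in
  \<open>(\<sigma>\<^sup>j)\<^sup>-\<^sup>1\<sigma>\<^sup>k\<close> or \<open>(\<sigma>\<^sup>k)\<^sup>-\<^sup>1\<sigma>\<^sup>j\<close>, so the relation is a linear order.
\<close>
lemma no_chain_cycle:
  assumes ch: "metasylvester_chain m n ch" and "j \<in> {1..m}" "k \<in> {1..m}"
    and abc: "a \<in> {1..n}" "c \<in> {1..n}" "a < b" "b < c"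
  shows "(a, b) \<notin> coinv n (component ch j) \<Longrightarrow> (b, c) \<notin> coinv n (component ch k) \<Longrightarrow>
      (a, c) \<notin> coinv n (component ch k)"
    and "(a, b) \<in> coinv n (component ch j) \<Longrightarrow> (b, c) \<in> coinv n (component ch k) \<Longrightarrow>
      (a, c) \<in> coinv n (component ch k)"
proof -
  let ?s = "\<lambda>i. inv (component ch i)"
  have b: "b \<in> {1..n}" using abc by auto
  have perm: "component ch i permutes {1..n}" if "i \<in> {1..m}" for i
    using ch that by (auto simp: metasylvester_chain_def)
  have inj: "?s i x \<noteq> ?s i y" if "i \<in> {1..m}" "x \<noteq> y" for i x y
    using permutes_inj[OF permutes_inv[OF perm[OF that(1)]]] that(2) by (auto dest: injD)
  have co: "(x, y) \<in> coinv n (component ch i) \<longleftrightarrow> ?s i y < ?s i x"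
    if "i \<in> {1..m}" "x \<in> {1..n}" "y \<in> {1..n}" "x < y" for i x y
    using coinv_iff_inv[OF perm[OF that(1)]] that by auto
  note mono = metasylvester_chain_antimono[OF ch]
  note av = metasylvester_chain_avoids[OF ch]
  show "(a, c) \<notin> coinv n (component ch k)"
    if ab: "(a, b) \<notin> coinv n (component ch j)" and bc: "(b, c) \<notin> coinv n (component ch k)"
  proof
    assume ac: "(a, c) \<in> coinv n (component ch k)"
    have k: "?s k c < ?s k a" "?s k b < ?s k c"
      using ac bc co[of k] inj[of k b c] abc b assms(3) by force+
    then have "(a, b) \<in> coinv n (component ch k)" using co[of k a b] abc b assms(3) by simp
    then have jk: "k < j" using ab mono[of j k] assms(2,3) by (meson atLeastAtMost_iff not_le subsetD)
    then have "(b, c) \<notin> coinv n (component ch j)" using bc mono[of k j] assms(2,3) by auto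
    then have "?s j b < ?s j c" "?s j a < ?s j b"
      using ab co[of j] inj[of j] abc b assms(2)
      by (metis linorder_neqE_nat less_irrefl)+
    \<comment> \<open>Now \<open>component ch k\<close> reads \<open>b c a\<close> and
      \<open>component ch j\<close> reads \<open>a b c\<close>, with \<open>k < j\<close>.\<close>
    then show False using av[of k j a b c] jk k assms(2,3) abc b by auto
  qed
  show "(a, c) \<in> coinv n (component ch k)"
    if ab: "(a, b) \<in> coinv n (component ch j)" and bc: "(b, c) \<in> coinv n (component ch k)"
  proof (rule ccontr)
    assume ac: "(a, c) \<notin> coinv n (component ch k)"
    have k: "?s k a < ?s k c" "?s k c < ?s k b"
      using ac bc co[of k] inj[of k a c] abc b assms(3) by force+
    then have "(a, b) \<notin> coinv n (component ch k)" using co[of k a b] abc b assms(3) by simp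
    then have jk: "j < k" using ab mono[of k j] assms(2,3) by (meson atLeastAtMost_iff not_le subsetD)
    then have "(b, c) \<in> coinv n (component ch j)" using bc mono[of j k] assms(2,3) by auto
    then have "?s j c < ?s j b" "?s j b < ?s j a"
      using ab co[of j] abc b assms(2) by auto
    \<comment> \<open>Now \<open>component ch j\<close> reads \<open>c b a\<close> and
      \<open>component ch k\<close> reads \<open>a c b\<close>, with \<open>j < k\<close>.\<close>
    then show False using av[of j k a c b] jk k assms(2,3) abc b by auto
  qed
qed

section \<open>Linearity of the prescribed order\<close>

lemma chain_rel_total: "totalp_on A (chain_rel n c)"
  by (auto simp: totalp_on_def chain_rel_def)

lemma chain_rel_asym: "asymp_on A (chain_rel n c)"
  by (auto simp: asymp_on_def chain_rel_def)

lemma chain_rel_trans: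
  assumes ch: "metasylvester_chain m n c"
  shows "transp_on ({1..n} \<times> {1..m}) (chain_rel n c)"
proof (rule transp_onI, clarify)
  fix x i y j z k
  assume A: "x \<in> {1..n}" "i \<in> {1..m}" "y \<in> {1..n}" "j \<in> {1..m}" "z \<in> {1..n}" "k \<in> {1..m}"
    and r: "chain_rel n c (x, i) (y, j)" "chain_rel n c (y, j) (z, k)"
  let ?K = "\<lambda>i. coinv n (component c i)"
  note mono = metasylvester_chain_antimono[OF ch]
  note cyc = no_chain_cycle[OF ch]
  \<comment> \<open>Coincidences among the letters come first, then their six strict orders.\<close>
  consider "x = y" "y = z" | "x = y" "y \<noteq> z" | "y = z" "x \<noteq> y" | "x = z" "x \<noteq> y"
    | "x < y" "y < z" | "x < z" "z < y" | "y < x" "x < z" | "y < z" "z < x" | "z < x" "x < y" | "z < y" "y < x"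
    by linarith
  then show "chain_rel n c (x, i) (z, k)"
  proof cases
    case 1 then show ?thesis using r by (auto simp: chain_rel_def)
  next
    case 2 then show ?thesis using r A mono[of i j] by (auto simp: chain_rel_def)
  next
    case 3 then show ?thesis using r A mono[of j k] by (auto simp: chain_rel_def)
  next
    case 4
    \<comment> \<open>If \<open>x < y\<close>, the hypotheses contradict each other. If
      \<open>y < x\<close>, then \<open>(y, x)\<close> lies in \<open>?K i\<close> but not in
      \<open>?K k\<close>, and antimonotonicity excludes \<open>k \<le> i\<close>.\<close>
    then have "\<not> ?K i \<subseteq> ?K k \<or> \<not> ?K k \<subseteq> ?K i \<or> i < k"
      using r by (auto simp: chain_rel_def)
    then show ?thesis using 4 r A mono[of k i] by (cases "i < k") (auto simp: chain_rel_def)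
  next
    \<comment> \<open>From here on, the indices given to \<open>cyc\<close> are those of the middle
      and of the largest letter.\<close>
    case 5 then show ?thesis using r A cyc(1)[of j k x z y] by (auto simp: chain_rel_def)
  next
    case 6 then show ?thesis using r A cyc(2)[of k j x y z] by (auto simp: chain_rel_def)
  next
    case 7 then show ?thesis using r A cyc(2)[of i k y z x] by (auto simp: chain_rel_def)
  next
    case 8 then show ?thesis using r A cyc(1)[of k i y x z] by (auto simp: chain_rel_def)
  next
    case 9 then show ?thesis using r A cyc(1)[of i j z y x] by (auto simp: chain_rel_def)
  next
    case 10 then show ?thesis using r A cyc(2)[of j i z x y] by (auto simp: chain_rel_def)
  qed
qed

lemma ex_chain_word:
  assumes ch: "metasylvester_chain m n c" and m: "1 \<le> m"
  shows "\<exists>w. w \<in> m_permutations m n \<and> avoids_aba w \<and>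
    (\<forall>a b i. (b, i, a) \<in> last_inv m w \<longleftrightarrow> 1 \<le> i \<and> i \<le> m \<and> (a, b) \<in> coinv n (component c i))"
proof -
  let ?A = "{1..n} \<times> {1..m}"
  have "\<exists>L. distinct L \<and> set L = ?A \<and> sorted_wrt (chain_rel n c) L"
    by (intro ex_sorted_wrt_list chain_rel_trans[OF ch] chain_rel_asym chain_rel_total) simp
  then obtain L where L: "distinct L" "set L = ?A" "sorted_wrt (chain_rel n c) L" by blast
  define w where "w = map fst L"
  have bef: "(X, Y) \<in> before L \<longleftrightarrow> X \<in> ?A \<and> Y \<in> ?A \<and> chain_rel n c X Y" for X Y
  proof
    assume "(X, Y) \<in> before L"
    then show "X \<in> ?A \<and> Y \<in> ?A \<and> chain_rel n c X Y"
      using before_set sorted_wrt_before[OF L(3)] L(2) by metis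
  next
    assume *: "X \<in> ?A \<and> Y \<in> ?A \<and> chain_rel n c X Y"
    then have "X \<noteq> Y" "\<not> chain_rel n c Y X"
      using chain_rel_asym[of ?A n c] by (auto simp: asymp_on_def)
    then show "(X, Y) \<in> before L"
      using before_total[of X L Y] * L(2) sorted_wrt_before[OF L(3), of Y X] by blast
  qed
  let ?f = "\<lambda>a. if a \<in> {1..n} then m else 0"
  have lab: "lab w = L"
    unfolding w_def
  proof (rule lab_map_fst[where f = ?f])
    show "set L = {(a, i). 1 \<le> i \<and> i \<le> ?f a}" using L(2) by (auto split: if_splits)
    show "i < j" if "((a, i), (a, j)) \<in> before L" for a i j
      using that by (auto simp: bef chain_rel_def)
  qed (rule L(1))
  have "count_list w a = ?f a" for a
  proof -
    have "(a, i) \<in> set L \<longleftrightarrow> 1 \<le> i \<and> i \<le> count_list w a" for i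
      using set_lab[of w] lab by auto
    then have "a \<in> {1..n} \<and> i \<in> {1..m} \<longleftrightarrow> 1 \<le> i \<and> i \<le> count_list w a" for i
      using L(2) by auto
    \<comment> \<open>The instances at \<open>m\<close> and at the count itself bound the count from
      both sides; outside \<open>{1..n}\<close> the latter forces 0.\<close>
    from this[of m] this[of "count_list w a"] m show ?thesis by auto
  qed
  then have wp: "w \<in> m_permutations m n" by (simp add: m_permutations_iff)
  \<comment> \<open>For \<open>a < b\<close> the order of two occurrences depends only on the index
    of \<open>b\<close>, so no \<open>b\<close> lies between two \<open>a\<close>.\<close>
  have "avoids_aba w"
    unfolding avoids_aba_def lab bef by (auto simp: chain_rel_def)
  moreover have "(b, i, a) \<in> last_inv m w \<longleftrightarrow> 1 \<le> i \<and> i \<le> m \<and> (a, b) \<in> coinv n (component c i)" for a b i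
  proof -
    \<comment> \<open>Co-inversions involve only letters in \<open>{1..n}\<close>, so the prescribed
      pairs all occur in the sorted list.\<close>
    have "a \<in> {1..n} \<and> b \<in> {1..n} \<and> a < b" if "1 \<le> i" "i \<le> m" "(a, b) \<in> coinv n (component c i)"
      using that ch coinv_iff_inv[of "component c i" n a b] by (auto simp: metasylvester_chain_def)
    then show ?thesis
      unfolding last_inv_def lab using m by (auto simp: bef chain_rel_def)
  qed
  ultimately show ?thesis using wp by blast
qed

text \<open>Tree-inversions determine the irreducible word through \<open>last_inv\<close>, so the
  definite description in \<open>\<psi>\<close> picks exactly one class.\<close>

lemma psi_eq_class_of:
  assumes "metasylvester_chain m n c" "1 \<le> m"
  shows "\<exists>w. w \<in> m_permutations m n \<and> avoids_aba w \<and> \<psi> m n c = class_of m n w \<and>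
    (\<forall>a b i. (b, i, a) \<in> last_inv m w \<longleftrightarrow> 1 \<le> i \<and> i \<le> m \<and> (a, b) \<in> coinv n (component c i))"
proof -
  obtain w where w: "w \<in> m_permutations m n" "avoids_aba w"
    "\<And>a b i. (b, i, a) \<in> last_inv m w \<longleftrightarrow> 1 \<le> i \<and> i \<le> m \<and> (a, b) \<in> coinv n (component c i)"
    using ex_chain_word[OF assms] by blast
  have "\<psi> m n c = class_of m n w"
    unfolding \<psi>_def
  proof (rule the_equality)
    show "class_of m n w \<in> metasylvester_classes m n \<and> tree_inversions m n (class_of m n w) =
       {(a, b, i). 1 \<le> i \<and> i \<le> m \<and> (a, b) \<in> coinv n (component c i)}"
      unfolding tree_inversions_class_of[OF w(1,2) assms(2)] w(3)
      using w(1) by (simp add: metasylvester_classes_def class_of_def quotientI)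
  next
    fix X assume X: "X \<in> metasylvester_classes m n \<and> tree_inversions m n X =
       {(a, b, i). 1 \<le> i \<and> i \<le> m \<and> (a, b) \<in> coinv n (component c i)}"
    then obtain v where v: "v \<in> m_permutations m n" "avoids_aba v" "X = class_of m n v"
      using metasylvester_class_cases by blast
    then have "{(a, b, i). (b, i, a) \<in> last_inv m v} = {(a, b, i). (b, i, a) \<in> last_inv m w}"
      using X tree_inversions_class_of[OF v(1,2) assms(2)] w(3) by simp
    then have "last_inv m v = last_inv m w" by (auto simp: set_eq_iff)
    then show "X = class_of m n w" using last_inv_inject v w assms(2) by blast
  qed
  then show ?thesis using w by blast
qed

theorem proposition4p6:
  fixes m n :: nat and c\<^sub>1 c\<^sub>2 :: "(nat \<Rightarrow> nat) list"
  assumes "m \<ge> 1" and "n \<ge> 1"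
    and "metasylvester_chain m n c\<^sub>1"
    and "metasylvester_chain m n c\<^sub>2"
  shows "chain_le m n c\<^sub>1 c\<^sub>2 \<longleftrightarrow>
    (\<forall>i\<in>{1..m}. right_weak_le n (component c\<^sub>1 i) (component c\<^sub>2 i))"
proof -
  obtain u where u: "u \<in> m_permutations m n" "avoids_aba u" "\<psi> m n c\<^sub>1 = class_of m n u"
    "\<And>a b i. (b, i, a) \<in> last_inv m u \<longleftrightarrow> 1 \<le> i \<and> i \<le> m \<and> (a, b) \<in> coinv n (component c\<^sub>1 i)"
    using psi_eq_class_of[OF assms(3,1)] by blast
  obtain v where v: "v \<in> m_permutations m n" "avoids_aba v" "\<psi> m n c\<^sub>2 = class_of m n v"
    "\<And>a b i. (b, i, a) \<in> last_inv m v \<longleftrightarrow> 1 \<le> i \<and> i \<le> m \<and> (a, b) \<in> coinv n (component c\<^sub>2 i)"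
    using psi_eq_class_of[OF assms(4,1)] by blast
  have "chain_le m n c\<^sub>1 c\<^sub>2 \<longleftrightarrow> last_inv m u \<subseteq> last_inv m v"
    using u v assms(1)
    by (simp add: chain_le_def metasylvester_le_def class_max_class_of last_inv_subset_iff)
  \<comment> \<open>Sorting the triples by their index turns the inclusion into one inclusion of
    co-inversion sets for each \<open>i\<close>.\<close>
  also have "\<dots> \<longleftrightarrow> (\<forall>i\<in>{1..m}. right_weak_le n (component c\<^sub>1 i) (component c\<^sub>2 i))"
    using u(4) v(4) by (auto simp: right_weak_le_def subset_iff)
  finally show ?thesis .
qed

end
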